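(* Let $P\subseteq\mathbb{R}^n$ be a compact convex set, let $L>0$, and let $f\colon P\to\mathbb{R}$ be $L$-smooth. Let $x_t,v_t\in P$ with $x_t\neq v_t$ and $\langle\nabla f(x_t),x_t-v_t\rangle\ge 0$. Let $$\gamma_t=\min\left\{\frac{\langle\nabla f(x_t),x_t-v_t\rangle}{L\|x_t-v_t\|^2},\,1\right\},\qquad x_{t+1}=(1-\gamma_t)x_t+\gamma_t v_t.$$ Then $$\langle\nabla f(x_{t+1}),x_t-v_t\rangle\ge 0.$$
   Context: $\|\cdot\|$ is the Euclidean norm and $\langle\cdot,\cdot\rangle$ the standard inner product on $\mathbb{R}^n$. A differentiable function $f\colon P\to\mathbb{R}$ is $L$-smooth if $f(y)-f(x)\le\langle\nabla f(x),y-x\rangle+\frac{L}{2}\|y-x\|^2$ for all $x,y\in P$ (differentiable on $P$ means on an open set containing $P$). Convexity of $f$ is not assumed. *)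

theory Defs
  imports "HOL-Analysis.Analysis"
begin

definition gradient :: "('a::real_inner \<Rightarrow> real) \<Rightarrow> 'a \<Rightarrow> 'a"
  where "gradient f x = (THE D. GDERIV f x :> D)"

text \<open>A function on \<open>P\<close> is represented by a total function that is differentiable on some open
  superset of \<open>P\<close>; its values outside that open set are irrelevant.\<close>

definition smooth_on :: "real \<Rightarrow> ('a::euclidean_space) set \<Rightarrow> ('a \<Rightarrow> real) \<Rightarrow> bool"
  where "smooth_on L P f \<longleftrightarrow>
    (\<exists>U. open U \<and> P \<subseteq> U \<and> f differentiable_on U) \<and>
    (\<forall>x\<in>P. \<forall>y\<in>P. f y - f x \<le> gradient f x \<bullet> (y - x) + L / 2 * (norm (y - x))\<^sup>2)"

lemma gradient_eq: "gradient f x = D" if "GDERIV f x :> D"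
proof -
  have "D' = D" if "GDERIV f x :> D'" for D'
  proof -
    have "(\<lambda>h. h \<bullet> D') = (\<lambda>h. h \<bullet> D)"
      using has_derivative_unique[OF that[unfolded gderiv_def]
          \<open>GDERIV f x :> D\<close>[unfolded gderiv_def]] .
    then have "\<forall>h. h \<bullet> D' = h \<bullet> D"
      by (intro allI) (rule fun_cong)
    then show "D' = D"
      by (simp only: vector_eq_ldot)
  qed
  then show ?thesis
    unfolding gradient_def using that by (rule the_equality[rotated])
qed

lemma gderiv_gradient:
  fixes f :: "'a::euclidean_space \<Rightarrow> real"
  assumes "f differentiable (at x)"
  shows "GDERIV f x :> gradient f x"
proof -
  obtain f' where f': "(f has_derivative f') (at x)"
    using assms by (auto simp: differentiable_def)
  then interpret linear f' by (rule has_derivative_linear)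
  have "f' h = h \<bullet> adjoint f' 1" for h
    using adjoint_works[OF linear_axioms, of h 1] by simp
  then have "f' = (\<lambda>h. h \<bullet> adjoint f' 1)" by (rule ext)
  then have "GDERIV f x :> adjoint f' 1"
    using f' by (simp add: gderiv_def)
  then show ?thesis by (simp add: gradient_eq)
qed

end

(* Adding the smoothness inequality at (x, y) and at (y, x) cancels the function values and bounds the
   growth of the gradient along y - x by L |y - x|^2. With y = x' = x + \<gamma> (v - x) this gives
   <grad f x', x - v> \<ge> <grad f x, x - v> - \<gamma> L |x - v|^2, which the short step makes nonnegative. *)
theory Submission
  imports Defs
begin

text \<open>The two terms with \<open>L / 2\<close> add up to the constant \<open>L\<close>. The
  resulting bound is one-sided: for nonconvex \<open>f\<close> it does not make the gradient
  \<open>L\<close>-Lipschitz.\<close>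

lemma smooth_on_gradient_diff:
  fixes f :: "'a::euclidean_space \<Rightarrow> real"
  assumes "smooth_on L P f" "x \<in> P" "y \<in> P"
  shows "(gradient f y - gradient f x) \<bullet> (y - x) \<le> L * (norm (y - x))\<^sup>2"
proof -
  have "f y - f x \<le> gradient f x \<bullet> (y - x) + L / 2 * (norm (y - x))\<^sup>2"
    and "f x - f y \<le> gradient f y \<bullet> (x - y) + L / 2 * (norm (x - y))\<^sup>2"
    using assms by (auto simp: smooth_on_def)
  then show ?thesis
    by (simp add: norm_minus_commute[of x y] inner_diff_left inner_diff_right)
qed

theorem lemma4p11:
  fixes P :: "(real ^ 'n) set"
    and f :: "real ^ 'n \<Rightarrow> real"
    and L \<gamma>\<^sub>t :: real
    and x\<^sub>t v\<^sub>t x' :: "real ^ 'n"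
  assumes "compact P" and "convex P"
    and "L > 0"
    and "smooth_on L P f"
    and "x\<^sub>t \<in> P" and "v\<^sub>t \<in> P" and "x\<^sub>t \<noteq> v\<^sub>t"
    and "gradient f x\<^sub>t \<bullet> (x\<^sub>t - v\<^sub>t) \<ge> 0"
    and "\<gamma>\<^sub>t = min (gradient f x\<^sub>t \<bullet> (x\<^sub>t - v\<^sub>t) / (L * (norm (x\<^sub>t - v\<^sub>t))\<^sup>2)) 1"
    and "x' = (1 - \<gamma>\<^sub>t) *\<^sub>R x\<^sub>t + \<gamma>\<^sub>t *\<^sub>R v\<^sub>t"
  shows "gradient f x' \<bullet> (x\<^sub>t - v\<^sub>t) \<ge> 0"
proof -
  let ?d = "x\<^sub>t - v\<^sub>t" and ?g = "gradient f x\<^sub>t \<bullet> (x\<^sub>t - v\<^sub>t)"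
  define K where "K = L * (norm ?d)\<^sup>2"
  have "K > 0"
    using \<open>L > 0\<close> \<open>x\<^sub>t \<noteq> v\<^sub>t\<close> by (simp add: K_def)
  have \<gamma>: "\<gamma>\<^sub>t = min (?g / K) 1"
    using assms(9) by (simp add: K_def)
  have "0 \<le> \<gamma>\<^sub>t" "\<gamma>\<^sub>t \<le> 1"
    using \<open>K > 0\<close> \<open>?g \<ge> 0\<close> by (simp_all add: \<gamma>)
  \<comment> \<open>The minimum is at most its first argument \<open>?g / K\<close>, so this holds
    whether or not the step is capped at 1.\<close>
  have "\<gamma>\<^sub>t * K \<le> ?g"
    using \<open>K > 0\<close> by (simp add: \<gamma> pos_le_divide_eq[symmetric])
  show ?thesis
  \<comment> \<open>The other case cancels a factor \<open>\<gamma>\<^sub>t\<close>. For a zero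
    step, \<open>x'\<close> is \<open>x\<^sub>t\<close> and the claim is the assumption on
    \<open>?g\<close>.\<close>
  proof (cases "\<gamma>\<^sub>t = 0")
    case True
    then show ?thesis
      using assms(8,10) by simp
  next
    case False
    with \<open>0 \<le> \<gamma>\<^sub>t\<close> have "\<gamma>\<^sub>t > 0" by simp
    have "x' \<in> P"
      using \<open>convex P\<close> \<open>x\<^sub>t \<in> P\<close> \<open>v\<^sub>t \<in> P\<close> \<open>0 \<le> \<gamma>\<^sub>t\<close> \<open>\<gamma>\<^sub>t \<le> 1\<close>
      unfolding assms(10) by (simp add: convexD)
    have step: "x' - x\<^sub>t = - \<gamma>\<^sub>t *\<^sub>R ?d"
      unfolding assms(10) by (simp add: algebra_simps)
    have "(gradient f x' - gradient f x\<^sub>t) \<bullet> (x' - x\<^sub>t) \<le> L * (norm (x' - x\<^sub>t))\<^sup>2"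
      using smooth_on_gradient_diff \<open>smooth_on L P f\<close> \<open>x\<^sub>t \<in> P\<close> \<open>x' \<in> P\<close> .
    \<comment> \<open>The displacement \<open>- \<gamma>\<^sub>t *\<^sub>R ?d\<close> enters the
      left side linearly, its sign swapping the two gradients, and the right side quadratically, so
      one factor \<open>\<gamma>\<^sub>t\<close> survives cancellation.\<close>
    then have "\<gamma>\<^sub>t * (?g - gradient f x' \<bullet> ?d) \<le> \<gamma>\<^sub>t * (\<gamma>\<^sub>t * K)"
      unfolding step inner_scaleR_right norm_scaleR power_mult_distrib
      by (simp add: K_def inner_diff_left power2_eq_square algebra_simps)
    then have "?g - gradient f x' \<bullet> ?d \<le> \<gamma>\<^sub>t * K"
      using \<open>\<gamma>\<^sub>t > 0\<close> by (simp only: mult_le_cancel_left_pos)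
    with \<open>\<gamma>\<^sub>t * K \<le> ?g\<close> show ?thesis by linarith
  qed
qed

end
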